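(* Let $(a_n)_{n\ge0}$ be the sequence, listed in increasing order, of the non-negative integers $m$ such that $840m+289$ is a perfect square. Define $t(n)=0$ if $n\equiv 0,1,3,5,10,12,14,15 \pmod{16}$ and $t(n)=1$ otherwise. Then $$\sum_{n=0}^\infty(-1)^{t(n)}q^{a_n}=\frac{(q^2,q^5,q^7;q^7)_\infty}{(q^2,q^3;q^5)_\infty}.$$
   Context: Here $q$ is a complex number with $|q|<1$ (equivalently, the identity may be read as an identity of formal power series in $q$). For a complex number $a$, $(a;q)_\infty:=\prod_{i=0}^\infty(1-aq^i)$, and $(a_1,a_2,\dots,a_m;q)_\infty:=\prod_{j=1}^m(a_j;q)_\infty$. *)

theory Defs
  imports "HOL-Analysis.Analysis" "HOL-Computational_Algebra.Nth_Powers"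
begin

definition qpoch_inf :: "complex \<Rightarrow> complex \<Rightarrow> complex" where
  "qpoch_inf a q = (\<Prod>i. 1 - a * q ^ i)"

definition qpoch_infs :: "complex list \<Rightarrow> complex \<Rightarrow> complex" where
  "qpoch_infs as q = (\<Prod>a\<leftarrow>as. qpoch_inf a q)"

definition sq_indices :: "nat set" where
  "sq_indices = {m. is_square (840 * m + 289)}"

definition a_seq :: "nat \<Rightarrow> nat" where
  "a_seq n = enumerate sq_indices n"

definition t_seq :: "nat \<Rightarrow> nat" where
  "t_seq n = (if n mod 16 \<in> {0, 1, 3, 5, 10, 12, 14, 15} then 0 else 1)"

text \<open>The enumeration and the infinite product are only meaningful because of the following
  facts: the index set is infinite, and the product converges for all \<open>a\<close> when \<open>norm q < 1\<close>.\<close>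

lemma infinite_sq_indices: "infinite sq_indices"
proof -
  have "840 * j\<^sup>2 + 34 * j \<in> sq_indices" for j :: nat
  proof -
    have "840 * (840 * j\<^sup>2 + 34 * j) + 289 = (840 * j + 17)\<^sup>2"
      by (simp add: power2_eq_square algebra_simps)
    then show ?thesis
      unfolding sq_indices_def is_nth_power_def by blast
  qed
  moreover have "j \<le> 840 * j\<^sup>2 + 34 * j" for j :: nat
    by simp
  ultimately show ?thesis
    unfolding infinite_nat_iff_unbounded_le by blast
qed

lemma strict_mono_a_seq: "strict_mono a_seq"
  using infinite_sq_indices by (auto simp: a_seq_def strict_mono_def enumerate_mono)

lemma range_a_seq: "range a_seq = sq_indices"
  using range_enumerate[OF infinite_sq_indices] by (simp add: a_seq_def[abs_def])

lemma convergent_prod_qpoch_inf: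
  fixes a q :: complex
  assumes "norm q < 1"
  shows "convergent_prod (\<lambda>i. 1 - a * q ^ i)"
proof -
  have "summable (\<lambda>i. norm a * norm q ^ i)"
    using assms by (intro summable_mult summable_geometric) auto
  then have "abs_convergent_prod (\<lambda>i. 1 - a * q ^ i)"
    by (intro summable_imp_abs_convergent_prod) (simp add: norm_mult norm_power)
  then show ?thesis
    by (rule abs_convergent_prod_imp_convergent_prod)
qed

end

theory Submission
  imports Defs "HOL-Library.Nat_Bijection"
begin

text \<open>
  Multiply the identity by \<open>(q;q)\<^sub>\<infinity>\<close>. Since \<open>(q;q)\<^sub>\<infinity> = (q,q\<^sup>4,q\<^sup>5;q\<^sup>5)\<^sub>\<infinity> (q\<^sup>2,q\<^sup>3;q\<^sup>5)\<^sub>\<infinity>\<close>, it remains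
  to show that the series times \<open>(q;q)\<^sub>\<infinity>\<close> equals \<open>(q\<^sup>2,q\<^sup>5,q\<^sup>7;q\<^sup>7)\<^sub>\<infinity> (q,q\<^sup>4,q\<^sup>5;q\<^sup>5)\<^sub>\<infinity>\<close>. By the
  Jacobi triple product both sides are signed sums over lattice points. The left-hand side has
  exponents \<open>(x\<^sup>2 + 35 y\<^sup>2 - 324) / 840\<close> with \<open>x\<close>, \<open>y\<close> odd and prime to \<open>3\<close>; the sign of \<open>x\<close> in the
  series is a character modulo \<open>12\<close> times a sign depending on \<open>x\<close> modulo \<open>5\<close> and \<open>7\<close>. Choosing the
  sign of \<open>y\<close> so that \<open>x + y = 6 t\<close>, the form becomes \<open>12 (3 t\<^sup>2 - t y + 3 y\<^sup>2)\<close>, which is invariant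
  under \<open>(t, y) \<mapsto> (-y, -t)\<close>, while the right-hand side is a sum over \<open>t + y\<close> odd for the same form.
  The points with \<open>3\<close> dividing \<open>y\<close> may be added on the left, because \<open>(x, y) \<mapsto> (x, -y)\<close> reverses
  their signs. The reflection then cancels the points with \<open>t\<close> and \<open>y\<close> odd and moves half of the
  remaining ones to the points of the right-hand side with \<open>y\<close> even.
\<close>

subsection \<open>The Jacobi triple product\<close>

lemma tendsto_qpoch_inf:
  fixes a q :: complex
  assumes "norm q < 1"
  shows "(\<lambda>n. \<Prod>i<n. 1 - a * q ^ i) \<longlonglongrightarrow> qpoch_inf a q"
  unfolding qpoch_inf_def
  using convergent_prod_qpoch_inf[OF assms, of a]
  by (intro has_prod_imp_tendsto' convergent_prod_has_prod)

text \<open>Factors are sorted by the residue of their index modulo \<open>m\<close>. This is a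
  rearrangement for the finite products of length \<open>n * m\<close>, and both sides pass to the
  limit.\<close>

lemma qpoch_inf_eq_prod_power:
  fixes a q :: complex
  assumes "norm q < 1" "m > 0"
  shows "qpoch_inf a q = (\<Prod>j<m. qpoch_inf (a * q ^ j) (q ^ m))"
proof (rule LIMSEQ_unique)
  have "norm (q ^ m) < 1"
    using assms by (simp add: norm_power power_less_one_iff)
  then show "(\<lambda>n. \<Prod>j<m. \<Prod>i<n. 1 - a * q ^ j * (q ^ m) ^ i)
      \<longlonglongrightarrow> (\<Prod>j<m. qpoch_inf (a * q ^ j) (q ^ m))"
    by (intro tendsto_prod tendsto_qpoch_inf)
  have "filterlim (\<lambda>n. n * m) at_top sequentially"
    using assms by (intro filterlim_at_top_mono[OF filterlim_ident]) auto
  then have "(\<lambda>n. \<Prod>i<n * m. 1 - a * q ^ i) \<longlonglongrightarrow> qpoch_inf a q"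
    using filterlim_compose[OF tendsto_qpoch_inf[OF assms(1), of a]] by blast
  moreover have "(\<Prod>i<n * m. 1 - a * q ^ i) = (\<Prod>j<m. \<Prod>i<n. 1 - a * q ^ j * (q ^ m) ^ i)" for n
  proof -
    have "(\<Prod>i<n * m. 1 - a * q ^ i) = (\<Prod>i<n. \<Prod>j\<in>{i * m..<i * m + m}. 1 - a * q ^ j)"
      by (rule prod.nat_group[symmetric])
    also have "\<dots> = (\<Prod>i<n. \<Prod>j<m. 1 - a * q ^ (j + i * m))"
    proof (rule prod.cong[OF refl])
      fix i
      show "(\<Prod>j\<in>{i * m..<i * m + m}. 1 - a * q ^ j) = (\<Prod>j<m. 1 - a * q ^ (j + i * m))"
        by (rule prod.reindex_bij_witness[of _ "\<lambda>j. j + i * m" "\<lambda>j. j - i * m"]) auto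
    qed
    also have "\<dots> = (\<Prod>j<m. \<Prod>i<n. 1 - a * q ^ j * (q ^ m) ^ i)"
      by (subst prod.swap)
        (simp add: power_add power_mult[symmetric] mult.assoc mult.commute[of m])
    finally show ?thesis .
  qed
  ultimately show "(\<lambda>n. \<Prod>j<m. \<Prod>i<n. 1 - a * q ^ j * (q ^ m) ^ i) \<longlonglongrightarrow> qpoch_inf a q"
    by simp
qed

lemma one_minus_power_Suc_nonzero:
  fixes q :: complex
  assumes "norm q < 1"
  shows "1 - q * q ^ i \<noteq> 0"
proof
  assume "1 - q * q ^ i = 0"
  then have "norm (q ^ Suc i) = 1"
    by simp
  moreover have "norm (q ^ Suc i) < 1"
    using assms by (simp add: norm_power power_less_one_iff del: power_Suc)
  ultimately show False by simp
qed

lemma qpoch_inf_self_nonzero: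
  assumes "norm q < 1"
  shows "qpoch_inf q q \<noteq> 0"
  unfolding qpoch_inf_def
  using convergent_prod_qpoch_inf[OF assms] one_minus_power_Suc_nonzero[OF assms]
  by (intro prodinf_nonzero)

section \<open>Gaussian binomials and the finite triple product\<close>

text \<open>The \<open>q\<close>-Pascal rule avoids division. For \<open>n < k\<close> the truncated
  exponent \<open>n - k\<close> does no harm, as \<open>gauss_binomial q n k\<close> is then
  0.\<close>

fun gauss_binomial :: "'a::comm_ring_1 \<Rightarrow> nat \<Rightarrow> nat \<Rightarrow> 'a" where
  "gauss_binomial q n 0 = 1"
| "gauss_binomial q 0 (Suc k) = 0"
| "gauss_binomial q (Suc n) (Suc k) =
     gauss_binomial q n (Suc k) + q ^ (n - k) * gauss_binomial q n k"

lemma gauss_binomial_eq_0: "n < k \<Longrightarrow> gauss_binomial q n k = 0"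
  by (induction q n k rule: gauss_binomial.induct) auto

lemma gauss_binomial_self: "gauss_binomial q n n = 1"
  by (induction n) (auto simp: gauss_binomial_eq_0)

text \<open>Division-free form of the quotient formula. By induction on \<open>j + k\<close>, the
  two terms of the Pascal rule combine through 1 - q^(j+k) = (1 - q^j) + q^j (1 - q^k).\<close>

lemma gauss_binomial_mult_prods:
  "gauss_binomial q (j + k) k * (\<Prod>i<k. 1 - q * q ^ i) * (\<Prod>i<j. 1 - q * q ^ i)
     = (\<Prod>i<j + k. 1 - q * q ^ i)"
proof (induction "j + k" arbitrary: j k)
  case (Suc n)
  define p where "p m = (\<Prod>i<m. 1 - q * q ^ i)" for m
  have p_Suc: "p (Suc m) = p m * (1 - q * q ^ m)" for m
    by (simp add: p_def)
  consider "j = 0" | "k = 0" | j' k' where "j = Suc j'" "k = Suc k'"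
    by (metis nat.exhaust)
  then show ?case
  proof cases
    case (3 j' k')
    have 1: "gauss_binomial q (j' + k) k * p k * p j' = p (j' + k)"
      using Suc(1)[of j' k] Suc(2) 3 unfolding p_def
      by (simp del: gauss_binomial.simps prod.lessThan_Suc)
    have 2: "gauss_binomial q (j + k') k' * p k' * p j = p (j + k')"
      using Suc(1)[of j k'] Suc(2) 3 unfolding p_def
      by (simp del: gauss_binomial.simps prod.lessThan_Suc)
    have eq: "j + k' = j' + k"
      using 3 by simp
    have "gauss_binomial q (j + k) k * p k * p j
        = gauss_binomial q (j' + k) k * p k * p j' * (1 - q * q ^ j')
          + q ^ j * (gauss_binomial q (j + k') k' * p k' * p j) * (1 - q * q ^ k')"
      using 3 by (simp add: p_Suc ring_distribs mult_ac eq)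
    also have "\<dots> = p (j' + k) * (1 - q * q ^ (j' + k))"
      unfolding eq 1 2[unfolded eq] using 3 by (simp add: algebra_simps power_add)
    also have "\<dots> = p (j + k)"
      using 3 by (simp add: p_Suc)
    finally show ?thesis unfolding p_def .
  qed (auto simp: gauss_binomial_self)
qed auto

text \<open>Multiplication by the new factor \<open>1 - x * q ^ n\<close> is the Pascal rule term by
  term, since q^n = q^(n-k) q^k and the triangular exponent grows by \<open>k\<close>.\<close>

theorem gauss_binomial_theorem:
  "(\<Prod>i<n. 1 - x * q ^ i) = (\<Sum>k\<le>n. (-1) ^ k * gauss_binomial q n k * q ^ (k choose 2) * x ^ k)"
proof (induction n)
  case (Suc n)
  let ?f = "\<lambda>k. (-1) ^ k * gauss_binomial q n k * q ^ (k choose 2) * x ^ k"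
  have "(\<Sum>k\<le>Suc n. (-1) ^ k * gauss_binomial q (Suc n) k * q ^ (k choose 2) * x ^ k)
      = 1 + (\<Sum>k\<le>n. ?f (Suc k) - x * q ^ n * ?f k)"
  proof -
    have "(-1) ^ Suc k * gauss_binomial q (Suc n) (Suc k) * q ^ (Suc k choose 2) * x ^ Suc k
        = ?f (Suc k) - x * q ^ n * ?f k" if "k \<le> n" for k
    proof -
      have "q ^ n = q ^ (n - k) * q ^ k"
        using that by (simp flip: power_add)
      moreover have "Suc k choose 2 = (k choose 2) + k"
        by (simp add: numeral_2_eq_2)
      ultimately show ?thesis
        by (simp add: algebra_simps power_add)
    qed
    then show ?thesis
      unfolding sum.atMost_Suc_shift[of _ n] by (simp add: numeral_2_eq_2)
  qed
  also have "\<dots> = (\<Sum>k\<le>Suc n. ?f k) - x * q ^ n * (\<Sum>k\<le>n. ?f k)"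
    unfolding sum.atMost_Suc_shift[of _ n]
    by (simp add: sum_subtractf sum_distrib_left numeral_2_eq_2)
  also have "(\<Sum>k\<le>Suc n. ?f k) = (\<Sum>k\<le>n. ?f k)"
    by (simp add: gauss_binomial_eq_0)
  finally show ?case
    using Suc by (simp add: algebra_simps)
qed (simp add: numeral_2_eq_2)

lemma int_choose_2: "2 * int (n choose 2) = int n * (int n - 1)"
proof (induction n)
  case (Suc n)
  then show ?case
    by (simp add: numeral_2_eq_2 algebra_simps)
qed (simp add: numeral_2_eq_2)

text \<open>The binomial theorem for \<open>2 * n\<close> factors at x = z q^(-n). The upper half of
  the factors is the product in \<open>z\<close>; the lower half, reversed, is the product in
  \<open>q / z\<close> up to the constant \<open>?c\<close>. The summation index is centred by k = n
  + m.\<close>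

lemma finite_jacobi_triple_product:
  fixes q z :: complex
  assumes "q \<noteq> 0" "z \<noteq> 0"
  shows "(\<Prod>i<n. 1 - z * q ^ i) * (\<Prod>i<n. 1 - q / z * q ^ i) =
    (\<Sum>m\<in>{-int n..int n}. gauss_binomial q (2 * n) (nat (int n + m)) *
       ((-1) powi m * q powi (m * (m - 1) div 2) * z powi m))"
proof -
  \<comment> \<open>The product of -z / q^i over i = 1, ..., n, pulled out of the lower half of the
    factors.\<close>
  let ?c = "(-z) powi (int n) * q powi (- (int n * (int n + 1) div 2))"
  let ?x = "z * q powi (- int n)"
  have c: "?c \<noteq> 0"
    using assms by simp
  have "(\<Prod>i<2 * n. 1 - ?x * q ^ i) = (\<Prod>i<n. 1 - ?x * q ^ i) * (\<Prod>i<n. 1 - ?x * q ^ (i + n))"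
  proof -
    have "(\<Prod>i\<in>{n..<n + n}. 1 - ?x * q ^ i) = (\<Prod>i<n. 1 - ?x * q ^ (i + n))"
      by (rule prod.reindex_bij_witness[of _ "\<lambda>i. i + n" "\<lambda>i. i - n"]) auto
    then show ?thesis
      using prod.nat_group[of "\<lambda>i. 1 - ?x * q ^ i" n 2]
      by (simp add: numeral_2_eq_2 lessThan_atLeast0)
  qed
  also have "(\<Prod>i<n. 1 - ?x * q ^ (i + n)) = (\<Prod>i<n. 1 - z * q ^ i)"
    using assms by (simp add: power_add power_int_minus field_simps)
  also have "(\<Prod>i<n. 1 - ?x * q ^ i) = (\<Prod>i<n. 1 - z / q ^ Suc i)"
  proof (rule prod.reindex_bij_witness[of _ "\<lambda>i. n - Suc i" "\<lambda>i. n - Suc i"])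
    fix i assume "i \<in> {..<n}"
    then have "n = (n - Suc i) + Suc i"
      by simp
    then have "q ^ n = q ^ Suc (n - Suc i) * q ^ i"
      by (metis power_add add_Suc_right add_Suc)
    then show "1 - z / q ^ Suc (n - Suc i) = 1 - ?x * q ^ i"
      using assms by (simp add: power_int_minus field_simps)
  qed auto
  also have "(\<Prod>i<n. 1 - z / q ^ Suc i) = ?c * (\<Prod>i<n. 1 - q / z * q ^ i)"
  proof (induction n)
    case (Suc n)
    have tri: "int (Suc n) * (int (Suc n) + 1) div 2 = int n * (int n + 1) div 2 + int (Suc n)"
    proof -
      have "int (Suc n) * (int (Suc n) + 1) = int n * (int n + 1) + int (Suc n) * 2"
        by (simp add: algebra_simps)
      then show ?thesis by simp
    qed
    have "(-z) powi int (Suc n) * q powi (- (int (Suc n) * (int (Suc n) + 1) div 2))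
        = (-z) powi (int n) * q powi (- (int n * (int n + 1) div 2)) * (- z / q ^ Suc n)"
      unfolding tri using assms
      by (simp add: power_int_add power_int_diff power_int_minus divide_simps)
    moreover have "1 - z / q ^ Suc n = (- z / q ^ Suc n) * (1 - q / z * q ^ n)"
      using assms by (simp add: field_simps)
    ultimately show ?case
      using Suc by (simp only: prod.lessThan_Suc mult_ac)
  qed simp
  finally have L: "(\<Prod>i<2 * n. 1 - ?x * q ^ i)
      = ?c * ((\<Prod>i<n. 1 - z * q ^ i) * (\<Prod>i<n. 1 - q / z * q ^ i))"
    by (simp add: mult_ac)
  have "(\<Sum>k\<le>2 * n. (-1) ^ k * gauss_binomial q (2 * n) k * q ^ (k choose 2) * ?x ^ k)
      = (\<Sum>m\<in>{-int n..int n}. ?c * (gauss_binomial q (2 * n) (nat (int n + m)) *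
       ((-1) powi m * q powi (m * (m - 1) div 2) * z powi m)))"
  proof (rule sum.reindex_bij_witness[of _ "\<lambda>m. nat (int n + m)" "\<lambda>k. int k - int n"])
    fix k assume "k \<in> {..2 * n}"
    define m where "m = int k - int n"
    have k: "int k = int n + m"
      by (simp add: m_def)
    \<comment> \<open>The part of the exponent that depends on \<open>n\<close> alone is the power
      of \<open>q\<close> in \<open>?c\<close>, so it cancels.\<close>
    have "even (m * (m - 1))" "even (int n * (int n + 1))"
      by auto
    then have e: "int (k choose 2) - int n * int k
        = m * (m - 1) div 2 - int n * (int n + 1) div 2"
      using int_choose_2[of k] unfolding k by (auto elim!: evenE simp: algebra_simps)
    have "q ^ (k choose 2) * ?x ^ k = q powi (int (k choose 2) - int n * int k) * z powi (int k)"
      using assms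
      by (simp add: power_mult_distrib power_int_diff power_int_minus power_int_mult
          field_simps flip: power_mult)
    also have "\<dots> = q powi (- (int n * (int n + 1) div 2)) * q powi (m * (m - 1) div 2) *
        (z powi int n * z powi m)"
      unfolding e using assms unfolding k
      by (simp add: power_int_add power_int_diff power_int_minus field_simps)
    finally have 1: "q ^ (k choose 2) * ?x ^ k = \<dots>" .
    have "(-1) ^ k = ((-1) powi (int k) :: complex)"
      by simp
    also have "\<dots> = (-1) powi int n * (-1) powi m"
      unfolding k by (simp add: power_int_add)
    finally have 2: "(-1) ^ k = ((-1) powi int n * (-1) powi m :: complex)" .
    have 3: "(-z) powi int n = (-1) powi int n * z powi int n"
      by (simp add: power_minus[of z])
    have "(-1) ^ k * gauss_binomial q (2 * n) k * q ^ (k choose 2) * ?x ^ k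
       = ((-1) ^ k) * gauss_binomial q (2 * n) k * (q ^ (k choose 2) * ?x ^ k)"
      by (simp only: mult_ac)
    also have "\<dots> = ?c * (gauss_binomial q (2 * n) k *
       ((-1) powi m * q powi (m * (m - 1) div 2) * z powi m))"
      unfolding 1 2 3 by (simp only: mult_ac)
    finally show "?c * (gauss_binomial q (2 * n) (nat (int n + (int k - int n))) *
        ((-1) powi (int k - int n) * q powi ((int k - int n) * (int k - int n - 1) div 2)
          * z powi (int k - int n)))
      = (-1) ^ k * gauss_binomial q (2 * n) k * q ^ (k choose 2) * ?x ^ k"
      unfolding m_def[symmetric] k[symmetric] nat_int by (rule sym)
  qed auto
  also have "(\<Sum>k\<le>2 * n. (-1) ^ k * gauss_binomial q (2 * n) k * q ^ (k choose 2) * ?x ^ k)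
      = ?c * ((\<Prod>i<n. 1 - z * q ^ i) * (\<Prod>i<n. 1 - q / z * q ^ i))"
    unfolding L[symmetric] by (rule gauss_binomial_theorem[symmetric])
  finally show ?thesis
    unfolding sum_distrib_left[symmetric] mult_left_cancel[OF c] .
qed


section \<open>Summability and the limit of the triple product\<close>

text \<open>The ratio of consecutive terms is \<open>q ^ n * z\<close>, which tends to 0.\<close>

lemma summable_partial_theta:
  fixes q z :: real
  assumes "0 \<le> q" "q < 1" "0 \<le> z"
  shows "summable (\<lambda>n. q ^ (n choose 2) * z ^ n)"
proof -
  have "(\<lambda>n. q ^ n * z) \<longlonglongrightarrow> 0 * z"
    using assms by (intro tendsto_mult tendsto_const LIMSEQ_power_zero) auto
  then have "eventually (\<lambda>n. q ^ n * z < 1 / 2) sequentially"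
    by (rule order_tendstoD) simp
  then obtain N where N: "\<And>n. n \<ge> N \<Longrightarrow> q ^ n * z < 1 / 2"
    by (auto simp: eventually_at_top_linorder)
  show ?thesis
  proof (rule summable_ratio_test[of "1 / 2" N])
    fix n assume "n \<ge> N"
    have "q ^ (Suc n choose 2) * z ^ Suc n = (q ^ n * z) * (q ^ (n choose 2) * z ^ n)"
      by (simp add: numeral_2_eq_2 power_add)
    also have "\<dots> \<le> 1 / 2 * (q ^ (n choose 2) * z ^ n)"
      using N[OF \<open>n \<ge> N\<close>] assms by (intro mult_right_mono) auto
    finally show "norm (q ^ (Suc n choose 2) * z ^ Suc n) \<le> 1 / 2 * norm (q ^ (n choose 2) * z ^ n)"
      using assms by (simp add: abs_mult)
  qed simp
qed

lemma summable_on_int_if_summable_nat: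
  fixes f :: "int \<Rightarrow> real"
  assumes "summable (\<lambda>n. f (int n))" "summable (\<lambda>n. f (- int n))" "\<And>m. f m \<ge> 0"
  shows "f summable_on UNIV"
proof -
  have "f summable_on range int"
    using assms by (subst summable_on_reindex)
      (auto simp: o_def intro!: summable_nonneg_imp_summable_on)
  moreover have "f summable_on range (\<lambda>n. - int n)"
    using assms by (subst summable_on_reindex)
      (auto simp: o_def inj_on_def intro!: summable_nonneg_imp_summable_on)
  ultimately have "f summable_on (range int \<union> range (\<lambda>n. - int n))"
    by (rule summable_on_union)
  also have "range int \<union> range (\<lambda>n. - int n) = UNIV"
    by (auto simp: image_def) (metis int_cases2)
  finally show ?thesis .
qed

lemma triangle_int: "(int n * (int n - 1)) div 2 = int (n choose 2)"
  using int_choose_2[of n] by simp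

lemma triangle_neg_int: "(- int n * (- int n - 1)) div 2 = int (n choose 2) + int n"
proof -
  have "(- int n * (- int n - 1)) = 2 * (int (n choose 2) + int n)"
    using int_choose_2[of n] by (simp add: algebra_simps)
  then show ?thesis by simp
qed

text \<open>Each half is a partial theta series: in \<open>z\<close> for the indices
  \<open>int n\<close>, in \<open>q / z\<close> for the indices \<open>- int n\<close>.\<close>

lemma summable_on_theta:
  fixes q z :: complex
  assumes "norm q < 1" "q \<noteq> 0" "z \<noteq> 0"
  shows "(\<lambda>m. norm ((-1) powi m * q powi (m * (m - 1) div 2) * z powi m)) summable_on UNIV"
proof (rule summable_on_int_if_summable_nat)
  show "summable (\<lambda>n. norm ((-1) powi int n * q powi (int n * (int n - 1) div 2) * z powi int n))"
    using summable_partial_theta[of "norm q" "norm z"] assms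
    by (simp add: triangle_int norm_mult norm_power)
  have "norm ((-1) powi (- int n) * q powi (- int n * (- int n - 1) div 2) * z powi (- int n))
      = norm q ^ (n choose 2) * norm (q / z) ^ n" for n
    using assms unfolding triangle_neg_int
    by (simp add: norm_mult norm_power power_int_add power_int_minus norm_divide norm_inverse field_simps)
  then show "summable (\<lambda>n. norm ((-1) powi (- int n) * q powi (- int n * (- int n - 1) div 2)
      * z powi (- int n)))"
    using summable_partial_theta[of "norm q" "norm (q / z)"] assms by simp
qed simp

text \<open>Tannery's theorem applied to the finite form: for fixed \<open>m\<close> the Gaussian
  binomial tends to 1 / (q;q)_inf, and all of them are bounded uniformly.\<close>

theorem jacobi_triple_product:
  fixes q z :: complex
  assumes q: "norm q < 1" "q \<noteq> 0" and z: "z \<noteq> 0"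
  shows "((\<lambda>m. (-1) powi m * q powi (m * (m - 1) div 2) * z powi m) has_sum
    (qpoch_inf q q * qpoch_inf z q * qpoch_inf (q / z) q)) UNIV"
proof -
  define p where "p n = (\<Prod>i<n. 1 - q * q ^ i)" for n
  define P where "P = qpoch_inf q q"
  define f where "f m = (-1) powi m * q powi (m * (m - 1) div 2) * z powi m" for m :: int
  define g where "g m n = (if m \<in> {- int n..int n}
    then gauss_binomial q (2 * n) (nat (int n + m)) * f m else 0)" for m n
  have p_lim: "p \<longlonglongrightarrow> P"
    unfolding p_def P_def using q by (intro tendsto_qpoch_inf)
  have P0: "P \<noteq> 0" and p0: "p n \<noteq> 0" for n
    using q qpoch_inf_self_nonzero one_minus_power_Suc_nonzero by (auto simp: P_def p_def)
  have gauss: "gauss_binomial q (2 * n) (nat (int n + m)) =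
      p (2 * n) / (p (nat (int n + m)) * p (nat (int n - m)))"
    if "m \<in> {- int n..int n}" for m n
  proof -
    have "nat (int n - m) + nat (int n + m) = 2 * n"
      using that by auto
    then show ?thesis
      using gauss_binomial_mult_prods[of q "nat (int n - m)" "nat (int n + m)"] p0
      unfolding p_def by (simp add: field_simps)
  qed
  \<comment> \<open>Bounds for \<open>p\<close> and for its inverse give one bound
    \<open>K * (L * L)\<close> for all Gaussian binomials that occur.\<close>
  have "Bseq p"
    using p_lim convergentI convergent_imp_Bseq by blast
  then obtain K where K: "\<And>n. norm (p n) \<le> K"
    by (auto simp: Bseq_def)
  have "(\<lambda>n. inverse (p n)) \<longlonglongrightarrow> inverse P"
    using p_lim P0 by (rule tendsto_inverse)
  then have "Bseq (\<lambda>n. inverse (p n))"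
    using convergentI convergent_imp_Bseq by blast
  then obtain L where L: "\<And>n. norm (inverse (p n)) \<le> L"
    by (auto simp: Bseq_def)
  have K0: "0 \<le> K" and L0: "0 \<le> L"
    using K[of 0] L[of 0] norm_ge_zero order_trans by blast+
  have bound: "norm (g m n) \<le> K * (L * L) * norm (f m)" for m n
  proof (cases "m \<in> {- int n..int n}")
    case True
    have "norm (p (2 * n) * (inverse (p (nat (int n + m))) * inverse (p (nat (int n - m)))))
        \<le> K * (L * L)"
      unfolding norm_mult by (intro mult_mono K L K0 L0 mult_nonneg_nonneg norm_ge_zero)
    then have "norm (gauss_binomial q (2 * n) (nat (int n + m))) \<le> K * (L * L)"
      unfolding gauss[OF True] by (simp add: divide_inverse)
    then show ?thesis
      unfolding g_def using True by (auto simp: norm_mult intro!: mult_right_mono)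
  qed (use K0 L0 in \<open>auto simp: g_def\<close>)
  have lim: "(\<lambda>n. g m n) \<longlonglongrightarrow> f m / P" for m
  proof -
    have shift: "filterlim (\<lambda>n. nat (int n + c)) at_top sequentially" for c
    proof (rule filterlim_at_top_mono[of "\<lambda>n. n - nat (-c)"])
      show "filterlim (\<lambda>n. n - nat (-c)) at_top sequentially"
        by (rule filterlim_minus_const_nat_at_top)
    qed (auto intro!: always_eventually)
    have double: "filterlim (\<lambda>n::nat. 2 * n) at_top sequentially"
      by (intro filterlim_at_top_mono[OF filterlim_ident]) auto
    have "(\<lambda>n. p (2 * n) / (p (nat (int n + m)) * p (nat (int n + (- m)))) * f m)
        \<longlonglongrightarrow> P / (P * P) * f m"
      using P0 by (intro tendsto_intros filterlim_compose[OF p_lim] shift double) auto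
    moreover have "eventually (\<lambda>n. p (2 * n) / (p (nat (int n + m)) * p (nat (int n + (- m)))) * f m
        = g m n) sequentially"
      using eventually_ge_at_top[of "nat \<bar>m\<bar>"]
      by eventually_elim (auto simp: g_def gauss)
    ultimately show ?thesis
      using P0 by (auto dest: Lim_transform_eventually)
  qed
  have f_summable: "(\<lambda>m. norm (f m)) summable_on UNIV"
    using summable_on_theta[OF q z] unfolding f_def .
  \<comment> \<open>Listing the integers by \<open>int_decode\<close> turns the sum into a series,
    to which Tannery's theorem applies.\<close>
  then have "(\<lambda>k. norm (f (int_decode k))) summable_on UNIV"
    using summable_on_reindex_bij_betw[OF bij_int_decode, of "\<lambda>m. norm (f m)"] by simp
  then have M: "summable (\<lambda>k. K * (L * L) * norm (f (int_decode k)))"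
    by (intro summable_mult summable_on_imp_summable)
  have tannery: "eventually (\<lambda>n. summable (\<lambda>k. norm (g (int_decode k) n))) sequentially \<and>
      summable (\<lambda>k. norm (f (int_decode k) / P)) \<and>
      ((\<lambda>n. \<Sum>k. g (int_decode k) n) \<longlonglongrightarrow> (\<Sum>k. f (int_decode k) / P))"
    by (rule tannerys_theorem[OF lim _ M]) (auto intro!: always_eventually bound)
  have "(\<Sum>k. g (int_decode k) n) = (\<Prod>i<n. 1 - z * q ^ i) * (\<Prod>i<n. 1 - q / z * q ^ i)" for n
  proof -
    have "((\<lambda>m. g m n) has_sum (\<Sum>m\<in>{- int n..int n}. g m n)) UNIV"
      by (rule has_sum_finite_neutralI[of "{- int n..int n}"]) (auto simp: g_def)
    then have "((\<lambda>k. g (int_decode k) n) has_sum (\<Sum>m\<in>{- int n..int n}. g m n)) UNIV"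
      by (simp only: has_sum_reindex_bij_betw[OF bij_int_decode, of "\<lambda>m. g m n"])
    then have "(\<Sum>k. g (int_decode k) n) = (\<Sum>m\<in>{- int n..int n}. g m n)"
      by (rule sums_unique[OF has_sum_imp_sums, symmetric])
    also have "\<dots> = (\<Sum>m\<in>{- int n..int n}. gauss_binomial q (2 * n) (nat (int n + m)) *
       ((-1) powi m * q powi (m * (m - 1) div 2) * z powi m))"
      by (rule sum.cong[OF refl]) (simp only: g_def f_def if_True)
    also have "\<dots> = (\<Prod>i<n. 1 - z * q ^ i) * (\<Prod>i<n. 1 - q / z * q ^ i)"
      by (rule finite_jacobi_triple_product[OF q(2) z, symmetric])
    finally show ?thesis .
  qed
  moreover have "(\<lambda>n. (\<Prod>i<n. 1 - z * q ^ i) * (\<Prod>i<n. 1 - q / z * q ^ i))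
      \<longlonglongrightarrow> qpoch_inf z q * qpoch_inf (q / z) q"
    using q by (intro tendsto_mult tendsto_qpoch_inf)
  ultimately have suminf: "(\<Sum>k. f (int_decode k) / P) = qpoch_inf z q * qpoch_inf (q / z) q"
    using tannery by (auto intro: LIMSEQ_unique)
  have abs_summable: "summable (\<lambda>k. norm (f (int_decode k) / P))"
    using tannery by blast
  have "((\<lambda>k. f (int_decode k) / P) has_sum (qpoch_inf z q * qpoch_inf (q / z) q)) UNIV"
    using summable_sums[OF summable_norm_cancel[OF abs_summable]] suminf
    by (intro norm_summable_imp_has_sum[OF abs_summable]) simp
  then have "((\<lambda>m. f m / P) has_sum (qpoch_inf z q * qpoch_inf (q / z) q)) UNIV"
    by (simp only: has_sum_reindex_bij_betw[OF bij_int_decode, of "\<lambda>m. f m / P"])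
  from has_sum_cmult_right[OF this, of P] show ?thesis
    using P0 by (simp add: f_def P_def mult.assoc)
qed

text \<open>The triple product in base \<open>q ^ m\<close> at \<open>z = q ^ a\<close>. Because
  \<open>0 < a\<close> and \<open>a < m\<close>, the exponent is non-negative for every integer
  \<open>n\<close>, so \<open>nat\<close> does not truncate it.\<close>

lemma has_sum_theta_power:
  fixes q :: complex
  assumes q: "norm q < 1" "q \<noteq> 0" and a: "0 < a" "a < m"
  shows "((\<lambda>n::int. (-1) powi n * q ^ nat (int m * (n * (n - 1) div 2) + int a * n)) has_sum
    qpoch_infs [q ^ a, q ^ (m - a), q ^ m] (q ^ m)) UNIV"
proof -
  have nonneg: "int m * (n * (n - 1) div 2) + int a * n \<ge> 0" for n
  proof (cases "n \<ge> 0")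
    case True
    then show ?thesis
      by (cases "n = 0") (auto simp: pos_imp_zdiv_nonneg_iff)
  next
    case False
    then have "0 \<le> (- n) * (- n - 1)"
      by (intro mult_nonneg_nonneg) auto
    then have "- n * 2 \<le> n * (n - 1)"
      by (simp add: algebra_simps)
    then have "- n \<le> n * (n - 1) div 2"
      by linarith
    then have "int m * (- n) \<le> int m * (n * (n - 1) div 2)"
      by (intro mult_left_mono) auto
    moreover have "int a * (- n) \<le> int m * (- n)"
      using False a by (intro mult_right_mono) auto
    ultimately show ?thesis by simp
  qed
  have "q ^ m / q ^ a = q ^ (m - a)"
    using q a by (simp add: power_diff)
  moreover have "norm (q ^ m) < 1"
    using assms by (simp add: norm_power power_less_one_iff)
  moreover have "(q ^ m) powi (n * (n - 1) div 2) * (q ^ a) powi n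
      = q ^ nat (int m * (n * (n - 1) div 2) + int a * n)" for n
  proof -
    have "q ^ nat (int m * (n * (n - 1) div 2) + int a * n)
        = q powi (int m * (n * (n - 1) div 2) + int a * n)"
      using nonneg[of n] by (simp only: power_int_def if_True)
    also have "\<dots> = q powi (int m * (n * (n - 1) div 2)) * q powi (int a * n)"
      using q by (subst power_int_add) auto
    also have "\<dots> = (q powi int m) powi (n * (n - 1) div 2) * (q powi int a) powi n"
      by (simp only: power_int_mult)
    finally show ?thesis
      by (simp only: power_int_of_nat)
  qed
  ultimately show ?thesis
    using jacobi_triple_product[of "q ^ m" "q ^ a"] q by (simp add: qpoch_infs_def mult_ac)
qed

subsection \<open>Sums over the lattice\<close>

text \<open>Summability of complex families is absolute, so the product family is summable and may
  be summed row by row.\<close>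

lemma has_sum_Times:
  fixes f :: "'a \<Rightarrow> complex" and g :: "'b \<Rightarrow> complex"
  assumes f: "(f has_sum a) A" and g: "(g has_sum b) B"
  shows "((\<lambda>(x, y). f x * g y) has_sum (a * b)) (A \<times> B)"
proof (rule has_sum_SigmaI)
  have f': "(\<lambda>x. norm (f x)) summable_on A" and g': "(\<lambda>y. norm (g y)) summable_on B"
    using f g has_sum_imp_summable summable_on_iff_abs_summable_on_complex by blast+
  show "((\<lambda>x. f x * b) has_sum (a * b)) A"
    using f by (rule has_sum_cmult_left)
  show "(\<lambda>(x, y). f x * g y) summable_on A \<times> B"
  proof (rule abs_summable_summable, subst Infinite_Sum.abs_summable_on_Sigma_iff, intro conjI ballI)
    fix x
    show "(\<lambda>y. norm (case (x, y) of (x, y) \<Rightarrow> f x * g y)) summable_on B"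
      using g' by (simp add: norm_mult summable_on_cmult_right)
    show "(\<lambda>x. norm (\<Sum>\<^sub>\<infinity>y\<in>B. norm (case (x, y) of (x, y) \<Rightarrow> f x * g y))) summable_on A"
      using f' by (simp add: norm_mult abs_mult infsum_cmult_right' summable_on_cmult_left)
  qed
qed (use g in \<open>auto intro: has_sum_cmult_right\<close>)

text \<open>The pair \<open>(t, y)\<close> stands for \<open>(x + y \<surd>-35) / 2\<close> with \<open>x = 6 t - y\<close>, so that
  \<open>x\<^sup>2 + 35 y\<^sup>2 = 12 (3 t\<^sup>2 - t y + 3 y\<^sup>2)\<close> and the exponent below is
  \<open>(x\<^sup>2 - 289) / 840 + (y\<^sup>2 - 1) / 24\<close>.\<close>

definition lattice_term :: "complex \<Rightarrow> int \<times> int \<Rightarrow> complex" where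
  "lattice_term q = (\<lambda>(t, y). q ^ nat ((3 * t\<^sup>2 - t * y + 3 * y\<^sup>2 - 27) div 70))"

text \<open>The quadratic form dominates |t| + |y|, so a product of two geometric series in the 70th
  root of \<open>norm q\<close> is a majorant.\<close>

lemma abs_summable_lattice_term:
  assumes q: "norm q < 1" "q \<noteq> 0"
  shows "(\<lambda>p. norm (lattice_term q p)) summable_on A"
proof -
  define s where "s = root 70 (norm q)"
  have s: "0 < s" "s < 1" "s ^ 70 = norm q"
    using q by (auto simp: s_def)
  define h where "h x = complex_of_real (s ^ nat \<bar>x\<bar>)" for x :: int
  have "(\<lambda>x. s ^ nat \<bar>x\<bar>) summable_on (UNIV :: int set)"
    using s by (intro summable_on_int_if_summable_nat) (auto intro!: summable_geometric)
  then have "h summable_on UNIV"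
    unfolding h_def by (rule summable_on_of_real)
  then have "(h has_sum infsum h UNIV) UNIV"
    by (rule has_sum_infsum)
  from has_sum_Times[OF this this]
  have "(\<lambda>(x, y). h x * h y) summable_on UNIV"
    by (auto dest: has_sum_imp_summable)
  then have "(\<lambda>p. norm ((case p of (x, y) \<Rightarrow> h x * h y) * of_real (inverse (s ^ 96)))) summable_on UNIV"
    by (intro summable_on_iff_abs_summable_on_complex[THEN iffD1] summable_on_cmult_left)
  then have "(\<lambda>p. norm ((case p of (x, y) \<Rightarrow> h x * h y) * of_real (inverse (s ^ 96)))) summable_on A"
    by (rule summable_on_subset) simp
  then show ?thesis
  proof (rule Infinite_Sum.abs_summable_on_comparison_test)
    fix p :: "int \<times> int" assume "p \<in> A"
    obtain x y where p: "p = (x, y)"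
      by fastforce
    define n where "n = nat ((3 * x\<^sup>2 - x * y + 3 * y\<^sup>2 - 27) div 70)"
    have sq: "\<bar>z\<bar> \<le> z\<^sup>2" for z :: int
      using self_le_power[of "\<bar>z\<bar>" 2] by (cases "z = 0") auto
    have "0 \<le> (x - y)\<^sup>2"
      by simp
    then have "2 * (x * y) \<le> x\<^sup>2 + y\<^sup>2"
      by (simp add: power2_diff)
    then have "\<bar>x\<bar> + \<bar>y\<bar> \<le> 3 * x\<^sup>2 - x * y + 3 * y\<^sup>2"
      using sq[of x] sq[of y] by linarith
    \<comment> \<open>96 = 27 + 69: the constant in the exponent plus the largest remainder modulo
      70.\<close>
    then have "\<bar>x\<bar> + \<bar>y\<bar> \<le> 70 * int n + 96"
      unfolding n_def by linarith
    then have "nat \<bar>x\<bar> + nat \<bar>y\<bar> \<le> 70 * n + 96"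
      by linarith
    then have "s ^ (70 * n + 96) \<le> s ^ (nat \<bar>x\<bar> + nat \<bar>y\<bar>)"
      using s by (intro power_decreasing) auto
    then have "norm q ^ n * s ^ 96 \<le> s ^ nat \<bar>x\<bar> * s ^ nat \<bar>y\<bar>"
      unfolding power_add power_mult s(3) .
    then have "norm q ^ n \<le> s ^ nat \<bar>x\<bar> * s ^ nat \<bar>y\<bar> * inverse (s ^ 96)"
      using s by (simp add: field_simps)
    then show "norm (lattice_term q p)
        \<le> norm ((case p of (x, y) \<Rightarrow> h x * h y) * of_real (inverse (s ^ 96)))"
      using s unfolding lattice_term_def p h_def
      by (simp add: norm_power norm_mult norm_inverse n_def)
  qed
qed

lemma summable_on_sign_lattice_term:
  assumes "norm q < 1" "q \<noteq> 0" "\<And>p. p \<in> A \<Longrightarrow> norm (c p) \<le> 1"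
  shows "(\<lambda>p. c p * lattice_term q p) summable_on A"
proof (rule abs_summable_summable, rule Infinite_Sum.abs_summable_on_comparison_test)
  show "(\<lambda>p. norm (lattice_term q p)) summable_on A"
    using assms by (intro abs_summable_lattice_term)
  show "norm (c p * lattice_term q p) \<le> norm (lattice_term q p)" if "p \<in> A" for p
    using assms(3)[OF that] by (simp add: norm_mult mult_left_le_one_le)
qed

text \<open>The reflection is an involution preserving the form. It fixes \<open>t - y\<close> and
  negates \<open>t + y\<close>, hence keeps the condition modulo 5 and swaps the residues 3 and 4
  modulo 7.\<close>

lemma infsum_reflect:
  fixes c d :: "int \<times> int \<Rightarrow> complex"
  assumes "\<And>t y. (t, y) \<in> S \<Longrightarrow> (- y, - t) \<in> T" "\<And>t y. (t, y) \<in> T \<Longrightarrow> (- y, - t) \<in> S"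
    and "\<And>t y. (t, y) \<in> S \<Longrightarrow> d (- y, - t) = c (t, y)"
  shows "infsum (\<lambda>p. c p * lattice_term q p) S = infsum (\<lambda>p. d p * lattice_term q p) T"
  using assms
  by (intro infsum_reindex_bij_witness[of _ "\<lambda>(t, y). (- y, - t)" "\<lambda>(t, y). (- y, - t)"])
    (auto simp: lattice_term_def algebra_simps)

section \<open>Cancellation in the lattice\<close>

text \<open>For x = 6 t - y the conditions say that x is odd, 2 modulo 5 and 3 or 4 modulo 7. Points
  with \<open>3 dvd y\<close> are included because the reflection does not respect that
  condition.\<close>

definition odd_lattice :: "(int \<times> int) set" where
  "odd_lattice = {(t, y). odd y \<and> (t - y) mod 5 = 2 \<and> (t + y) mod 7 \<in> {3, 4}}"

text \<open>The first factor is the sign of x modulo 7. The second is the character of x modulo 12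
  times (-1)^n, where y is 6 n - 1 or 1 - 6 n.\<close>

definition odd_sign :: "int \<times> int \<Rightarrow> complex" where
  "odd_sign = (\<lambda>(t, y). (if (t + y) mod 7 = 3 then 1 else -1) * (if even t then 1 else -1))"

text \<open>The points with t + y = 3 - 14 n and t - y = 10 k - 3, where \<open>n\<close> and
  \<open>k\<close> index the two theta series of the right-hand side.\<close>

definition theta_lattice :: "(int \<times> int) set" where
  "theta_lattice = {(t, y). odd (t + y) \<and> (t - y) mod 5 = 2 \<and> (t + y) mod 7 = 3}"

definition theta_sign :: "int \<times> int \<Rightarrow> complex" where
  "theta_sign = (\<lambda>(t, y). if odd y then 1 else -1)"

lemma neg_mod_7:
  fixes t y :: int
  shows "(- y - t) mod 7 = 3 \<longleftrightarrow> (t + y) mod 7 = 4" "(- y - t) mod 7 = 4 \<longleftrightarrow> (t + y) mod 7 = 3"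
proof -
  have "(- w) mod 7 = 3 \<longleftrightarrow> w mod 7 = 4" "(- w) mod 7 = 4 \<longleftrightarrow> w mod 7 = 3" for w :: int
    by presburger+
  moreover have "- y - t = - (t + y)"
    by simp
  ultimately show
    "(- y - t) mod 7 = 3 \<longleftrightarrow> (t + y) mod 7 = 4" "(- y - t) mod 7 = 4 \<longleftrightarrow> (t + y) mod 7 = 3"
    by metis+
qed

lemma infsum_odd_sign_dvd_3_eq_0:
  "infsum (\<lambda>p. odd_sign p * lattice_term q p) {p \<in> odd_lattice. 3 dvd snd p} = 0"
proof -
  let ?F = "\<lambda>p. odd_sign p * lattice_term q p"
  let ?U = "{p \<in> odd_lattice. 3 dvd snd p}"
  \<comment> \<open>This is \<open>(x, y) \<mapsto> (x, -y)\<close>, which is integral in \<open>(t, y)\<close> because \<open>3\<close> divides \<open>y\<close>.\<close>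
  let ?r = "\<lambda>(t, y). (t - y div 3, - y) :: int \<times> int"
  have ex: "\<exists>t s. p = (t, 3 * s) \<and> (t, 3 * s) \<in> odd_lattice" if "p \<in> ?U" for p
    using that by (cases p) (auto elim!: dvdE)
  have r: "?r (t, 3 * s) = (t - s, 3 * (- s))" for t s
    by simp
  \<comment> \<open>The two sides differ by multiples of 5 s and 7 s, so the involution respects
    both residue conditions.\<close>
  have mod_5: "(t - s - 3 * (- s)) mod 5 = (t - 3 * s) mod 5"
    and mod_7: "(t - s + 3 * (- s)) mod 7 = (t + 3 * s) mod 7" for t s :: int
    unfolding mod_eq_dvd_iff by (simp_all add: algebra_simps)
  have closed: "(t - s, 3 * (- s)) \<in> odd_lattice" if "(t, 3 * s) \<in> odd_lattice" for t s
    using that unfolding odd_lattice_def by (simp only: mem_Collect_eq prod.case mod_5 mod_7) simp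
  have "infsum ?F ?U = infsum (\<lambda>p. - ?F p) ?U"
  proof (rule infsum_reindex_bij_witness[of _ ?r ?r])
    fix p assume "p \<in> ?U"
    then obtain t s where p: "p = (t, 3 * s)" "(t, 3 * s) \<in> odd_lattice"
      using ex by blast
    show "?r (?r p) = p" "?r (?r p) = p"
      unfolding p r by simp_all
    show "?r p \<in> ?U" "?r p \<in> ?U"
      unfolding p r using closed[OF p(2)] by simp_all
    \<comment> \<open>Hence \<open>t\<close> and \<open>t - s\<close> have opposite parity, which
      reverses the sign.\<close>
    have "odd s"
      using p(2) by (simp add: odd_lattice_def)
    then have "odd_sign (t - s, 3 * (- s)) = - odd_sign (t, 3 * s)"
      unfolding odd_sign_def prod.case mod_7 by simp
    moreover have "3 * (t - s)\<^sup>2 - (t - s) * (3 * - s) + 3 * (3 * - s)\<^sup>2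
        = 3 * t\<^sup>2 - t * (3 * s) + 3 * (3 * s)\<^sup>2"
      by (simp add: power2_eq_square algebra_simps)
    ultimately show "- ?F (?r p) = ?F p"
      unfolding p r lattice_term_def prod.case by simp
  qed
  then show ?thesis
    by (simp add: infsum_uminus)
qed

text \<open>After \<open>U\<close> is adjoined, the points with \<open>t\<close> odd form
  \<open>V\<close> and cancel. Those with \<open>t\<close> even split into \<open>S1\<close>, the
  part of \<open>theta_lattice\<close> with \<open>y\<close> odd, and \<open>S2\<close>, which the
  reflection carries to the part \<open>S3\<close> with \<open>y\<close> even.\<close>

lemma lattice_sums_eq:
  assumes q: "norm q < 1" "q \<noteq> 0"
  shows "infsum (\<lambda>p. odd_sign p * lattice_term q p) {p \<in> odd_lattice. \<not> 3 dvd snd p}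
       = infsum (\<lambda>p. theta_sign p * lattice_term q p) theta_lattice"
proof -
  let ?F = "\<lambda>p. odd_sign p * lattice_term q p"
  let ?G = "\<lambda>p. theta_sign p * lattice_term q p"
  let ?H = "\<lambda>p. 1 * lattice_term q p"
  define U where "U = {p \<in> odd_lattice. 3 dvd snd p}"
  define V where "V = {p \<in> odd_lattice. odd (fst p)}"
  define S1 where "S1 = {p \<in> odd_lattice. even (fst p) \<and> (fst p + snd p) mod 7 = 3}"
  define S2 where "S2 = {p \<in> odd_lattice. even (fst p) \<and> (fst p + snd p) mod 7 = 4}"
  define S3 where "S3 = {p \<in> theta_lattice. even (snd p)}"
  have sF: "?F summable_on A" for A
    by (rule summable_on_sign_lattice_term[OF q]) (auto simp: odd_sign_def)
  have sG: "?G summable_on A" for A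
    by (rule summable_on_sign_lattice_term[OF q]) (auto simp: theta_sign_def)
  have U: "infsum ?F U = 0"
    unfolding U_def by (rule infsum_odd_sign_dvd_3_eq_0)
  \<comment> \<open>Both coordinates are odd on \<open>V\<close>, so the reflection maps
    \<open>V\<close> to itself and changes only the sign modulo 7.\<close>
  have "infsum ?F V = infsum (\<lambda>p. - odd_sign p * lattice_term q p) V"
    by (rule infsum_reflect) (auto simp: V_def odd_lattice_def odd_sign_def neg_mod_7 add.commute)
  then have V: "infsum ?F V = 0"
    by (simp add: infsum_uminus)
  have S23: "infsum ?H S2 = infsum ?H S3"
    by (rule infsum_reflect)
      (auto simp: S2_def S3_def odd_lattice_def theta_lattice_def neg_mod_7 add.commute)
  have "infsum ?F {p \<in> odd_lattice. \<not> 3 dvd snd p}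
      = infsum ?F ({p \<in> odd_lattice. \<not> 3 dvd snd p} \<union> U)"
    using U by (subst infsum_Un_disjoint[OF sF sF]) (auto simp: U_def)
  also have "{p \<in> odd_lattice. \<not> 3 dvd snd p} \<union> U = (S1 \<union> S2) \<union> V"
    by (auto simp: U_def V_def S1_def S2_def odd_lattice_def)
  also have "infsum ?F \<dots> = infsum ?F (S1 \<union> S2) + infsum ?F V"
    by (rule infsum_Un_disjoint[OF sF sF]) (auto simp: V_def S1_def S2_def)
  also have "\<dots> = infsum ?F S1 + infsum ?F S2"
    unfolding V by (subst infsum_Un_disjoint[OF sF sF]) (auto simp: S1_def S2_def)
  also have "infsum ?F S1 = infsum ?G S1"
    by (rule infsum_cong) (auto simp: S1_def odd_sign_def theta_sign_def odd_lattice_def)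
  also have "infsum ?F S2 = infsum (\<lambda>p. - ?H p) S2"
    by (rule infsum_cong) (auto simp: S2_def odd_sign_def)
  also have "\<dots> = infsum (\<lambda>p. - ?H p) S3"
    unfolding infsum_uminus S23 ..
  also have "\<dots> = infsum ?G S3"
    by (rule infsum_cong) (auto simp: S3_def theta_sign_def)
  also have "infsum ?G S1 + infsum ?G S3 = infsum ?G (S1 \<union> S3)"
    by (rule infsum_Un_disjoint[OF sG sG, symmetric]) (auto simp: S1_def S3_def odd_lattice_def)
  also have "S1 \<union> S3 = theta_lattice"
    by (auto simp: S1_def S3_def odd_lattice_def theta_lattice_def)
  finally show ?thesis .
qed

section \<open>The theta products as a lattice sum\<close>

lemma triangle_obtain:
  fixes n :: int
  obtains T where "n * (n - 1) div 2 = T" "2 * T = n * n - n"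
  by (rule that[of "n * (n - 1) div 2"]) (simp_all add: right_diff_distrib)

lemma minus_one_powi_int: "(-1 :: complex) powi n = (if even n then 1 else -1)"
  by (simp add: power_int_minus_left)

text \<open>The form diagonalises as (5 (t + y)^2 + 7 (t - y)^2) / 4. With t + y = 3 - 14 n and t -
  y = 10 k - 3 it separates into the exponents of the two theta series, and 27 is its value at n = k
  = 0.\<close>

lemma has_sum_theta_lattice:
  assumes q: "norm q < 1" "q \<noteq> 0"
  shows "((\<lambda>p. theta_sign p * lattice_term q p) has_sum
    (qpoch_infs [q ^ 2, q ^ 5, q ^ 7] (q ^ 7) * qpoch_infs [q, q ^ 4, q ^ 5] (q ^ 5))) theta_lattice"
proof -
  have nonneg: "0 \<le> 7 * (n * (n - 1) div 2) + 2 * n" "0 \<le> 5 * (n * (n - 1) div 2) + n" for n :: int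
  proof -
    have "0 \<le> n * (7 * n - 3)" "0 \<le> n * (5 * n - 3)"
      by (cases "n \<ge> 1"; simp add: zero_le_mult_iff)+
    moreover obtain T where "n * (n - 1) div 2 = T" "2 * T = n * n - n"
      by (rule triangle_obtain)
    ultimately show "0 \<le> 7 * (n * (n - 1) div 2) + 2 * n" "0 \<le> 5 * (n * (n - 1) div 2) + n"
      by (simp_all add: right_diff_distrib)
  qed
  have "((\<lambda>n. (-1) powi n * q ^ nat (7 * (n * (n - 1) div 2) + 2 * n)) has_sum
      qpoch_infs [q ^ 2, q ^ 5, q ^ 7] (q ^ 7)) UNIV"
    using has_sum_theta_power[OF q, of 2 7] by simp
  moreover have "((\<lambda>n. (-1) powi n * q ^ nat (5 * (n * (n - 1) div 2) + n)) has_sum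
      qpoch_infs [q, q ^ 4, q ^ 5] (q ^ 5)) UNIV"
    using has_sum_theta_power[OF q, of 1 5] by simp
  ultimately have "((\<lambda>(n, k). ((-1) powi n * q ^ nat (7 * (n * (n - 1) div 2) + 2 * n)) *
      ((-1) powi k * q ^ nat (5 * (k * (k - 1) div 2) + k))) has_sum
      (qpoch_infs [q ^ 2, q ^ 5, q ^ 7] (q ^ 7) * qpoch_infs [q, q ^ 4, q ^ 5] (q ^ 5)))
      (UNIV \<times> UNIV)"
    by (rule has_sum_Times)
  also have "?this \<longleftrightarrow> ?thesis"
  proof (rule has_sum_reindex_bij_witness[of _
        "\<lambda>(t, y). ((3 - t - y) div 14, (t - y + 3) div 10)"
        "\<lambda>(n, k). (5 * k - 7 * n, 3 - 7 * n - 5 * k)"])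
    fix p :: "int \<times> int"
    obtain n k where p: "p = (n, k)"
      by fastforce
    show "(\<lambda>(t, y). ((3 - t - y) div 14, (t - y + 3) div 10))
        ((\<lambda>(n, k). (5 * k - 7 * n, 3 - 7 * n - 5 * k)) p) = p"
      unfolding p by simp
    have "(5 * k - 7 * n - (3 - 7 * n - 5 * k)) mod 5 = 2 mod 5"
      "(5 * k - 7 * n + (3 - 7 * n - 5 * k)) mod 7 = 3 mod 7"
      unfolding mod_eq_dvd_iff by simp_all
    moreover have "odd (5 * k - 7 * n + (3 - 7 * n - 5 * k))"
      by simp
    ultimately show "(\<lambda>(n, k). (5 * k - 7 * n, 3 - 7 * n - 5 * k)) p \<in> theta_lattice"
      unfolding p theta_lattice_def prod.case mem_Collect_eq by simp
    let ?e = "(7 * (n * (n - 1) div 2) + 2 * n) + (5 * (k * (k - 1) div 2) + k)"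
    have double_e: "2 * ?e = 7 * (n * (n - 1)) + 4 * n + (5 * (k * (k - 1)) + 2 * k)"
    proof -
      obtain T where "n * (n - 1) div 2 = T" "2 * T = n * n - n"
        by (rule triangle_obtain)
      moreover obtain T' where "k * (k - 1) div 2 = T'" "2 * T' = k * k - k"
        by (rule triangle_obtain)
      ultimately show ?thesis
        by (simp add: right_diff_distrib)
    qed
    have "e * 70 = 35 * (2 * e)" for e :: int
      by simp
    then have "?e * 70 = 35 * (7 * (n * (n - 1)) + 4 * n + (5 * (k * (k - 1)) + 2 * k))"
      unfolding double_e[symmetric] .
    also have "\<dots> = 3 * (5 * k - 7 * n)\<^sup>2 - (5 * k - 7 * n) * (3 - 7 * n - 5 * k)
        + 3 * (3 - 7 * n - 5 * k)\<^sup>2 - 27"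
      by (simp add: power2_eq_square algebra_simps)
    finally have e: "(3 * (5 * k - 7 * n)\<^sup>2 - (5 * k - 7 * n) * (3 - 7 * n - 5 * k)
        + 3 * (3 - 7 * n - 5 * k)\<^sup>2 - 27) div 70 = ?e"
      by (metis nonzero_mult_div_cancel_right zero_neq_numeral)
    have "nat ?e = nat (7 * (n * (n - 1) div 2) + 2 * n) + nat (5 * (k * (k - 1) div 2) + k)"
      using nonneg(1)[of n] nonneg(2)[of k] by (rule nat_add_distrib)
    then have "lattice_term q (5 * k - 7 * n, 3 - 7 * n - 5 * k) =
        q ^ nat (7 * (n * (n - 1) div 2) + 2 * n) * q ^ nat (5 * (k * (k - 1) div 2) + k)"
      unfolding lattice_term_def prod.case e by (simp only: power_add)
    moreover have "theta_sign (5 * k - 7 * n, 3 - 7 * n - 5 * k) = (-1) powi n * (-1) powi k"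
      by (simp add: theta_sign_def minus_one_powi_int)
    ultimately show "theta_sign ((\<lambda>(n, k). (5 * k - 7 * n, 3 - 7 * n - 5 * k)) p) *
        lattice_term q ((\<lambda>(n, k). (5 * k - 7 * n, 3 - 7 * n - 5 * k)) p) =
        (case p of (n, k) \<Rightarrow> ((-1) powi n * q ^ nat (7 * (n * (n - 1) div 2) + 2 * n)) *
        ((-1) powi k * q ^ nat (5 * (k * (k - 1) div 2) + k)))"
      unfolding p prod.case by (simp only: mult_ac)
  next
    fix p assume "p \<in> theta_lattice"
    then obtain t y where p: "p = (t, y)" and
      res: "odd (t + y)" "(t - y) mod 5 = 2" "(t + y) mod 7 = 3"
      by (auto simp: theta_lattice_def)
    \<comment> \<open>Parity lifts the residues modulo 7 and 5 to residues modulo 14 and 10, so both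
      divisions are exact.\<close>
    have "14 * ((3 - t - y) div 14) = 3 - t - y"
      using res(1,3) by presburger
    moreover have "10 * ((t - y + 3) div 10) = t - y + 3"
      using res(1,2) by presburger
    ultimately show "(\<lambda>(n, k). (5 * k - 7 * n, 3 - 7 * n - 5 * k))
        ((\<lambda>(t, y). ((3 - t - y) div 14, (t - y + 3) div 10)) p) = p"
      unfolding p prod.case by simp
  qed auto
  finally show ?thesis .
qed

section \<open>The series as a lattice sum\<close>

text \<open>One representative of each pair \<open>\<plusminus>x\<close> with \<open>x\<^sup>2 \<equiv> 289 (mod 840)\<close>, normalised by
  \<open>x \<equiv> 2 (mod 5)\<close>.\<close>

definition root_set :: "int set" where
  "root_set = {x. odd x \<and> \<not> 3 dvd x \<and> x mod 5 = 2 \<and> x mod 7 \<in> {3, 4}}"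

text \<open>On \<open>root_set\<close> the first factor is the quadratic character modulo 12 with
  value 1 at 1 and -1 and value -1 at 5 and -5.\<close>

definition root_sign :: "int \<Rightarrow> complex" where
  "root_sign x = (if x mod 12 \<in> {1, 11} then 1 else -1) * (if x mod 7 = 4 then 1 else -1)"

text \<open>A finite check modulo 210 is lifted: for x = 210 k + c, the square changes by 420 k (105
  k + c), and k (105 k + c) is even because c is odd. The lower bound follows since 289 <
  840.\<close>

lemma root_set_square:
  assumes "x \<in> root_set"
  shows "840 dvd x\<^sup>2 - 289" "289 \<le> x\<^sup>2"
proof -
  define c where "c = x mod 210"
  define k where "k = x div 210"
  have x: "x = 210 * k + c"
    by (simp add: c_def k_def)
  have all: "\<forall>c\<in>set [0..209::int]. odd c \<and> \<not> 3 dvd c \<and> c mod 5 = 2 \<and> c mod 7 \<in> {3, 4}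
      \<longrightarrow> 840 dvd c\<^sup>2 - 289"
    by code_simp
  have "even c \<longleftrightarrow> even x" "3 dvd c \<longleftrightarrow> 3 dvd x" "c mod 5 = x mod 5" "c mod 7 = x mod 7"
    unfolding c_def by (auto simp: dvd_mod_iff mod_mod_cancel)
  moreover have "c \<in> set [0..209]"
    by (simp add: c_def)
  ultimately have c: "odd c" "840 dvd c\<^sup>2 - 289"
    using assms all unfolding root_set_def by auto
  have "even (105 * k + c) \<or> even k"
    using c by auto
  then have "840 dvd 420 * (k * (105 * k + c))"
    using mult_dvd_mono[of "420 :: int" 420 2 "k * (105 * k + c)"] by auto
  then have "840 dvd 420 * (k * (105 * k + c)) + (c\<^sup>2 - 289)"
    using c by (intro dvd_add)
  also have "420 * (k * (105 * k + c)) + (c\<^sup>2 - 289) = x\<^sup>2 - 289"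
    by (simp add: x power2_eq_square algebra_simps)
  finally show dvd: "840 dvd x\<^sup>2 - 289" .
  then obtain m where "x\<^sup>2 - 289 = 840 * m" ..
  moreover from this have "- 1 < m"
    using zero_le_power2[of x] by linarith
  ultimately show "289 \<le> x\<^sup>2"
    by linarith
qed

lemma root_set_iff_odd_lattice:
  "6 * t - y \<in> root_set \<longleftrightarrow> (t, y) \<in> odd_lattice \<and> \<not> 3 dvd y"
proof -
  have "odd (6 * t - y) \<longleftrightarrow> odd y" "3 dvd 6 * t - y \<longleftrightarrow> 3 dvd y"
    by presburger+
  moreover have "(6 * t - y) mod 5 = (t - y) mod 5" "(6 * t - y) mod 7 = (- y - t) mod 7"
    unfolding mod_eq_dvd_iff by simp_all
  ultimately show ?thesis
    by (auto simp: root_set_def odd_lattice_def neg_mod_7)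
qed

text \<open>Twelve times the form is x^2 + 35 y^2 with x = 6 t - y, and (y^2 - 1) / 24 is the
  pentagonal number n (3 n - 1) / 2, so the exponent splits.\<close>

lemma lattice_term_eq_mult:
  assumes "6 * t - y \<in> root_set" "y\<^sup>2 = (6 * n - 1)\<^sup>2"
  shows "lattice_term q (t, y) = q ^ nat (((6 * t - y)\<^sup>2 - 289) div 840) *
    q ^ nat (3 * (n * (n - 1) div 2) + n)"
proof -
  let ?e = "3 * (n * (n - 1) div 2) + n"
  obtain m where m: "(6 * t - y)\<^sup>2 - 289 = 840 * m"
    using root_set_square(1)[OF assms(1)] ..
  have "0 \<le> m"
    using root_set_square(2)[OF assms(1)] m by simp
  have "0 \<le> n * (3 * n - 1)"
    by (cases "n \<ge> 1"; simp add: zero_le_mult_iff)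
  moreover have e: "2 * ?e = n * (3 * n - 1)"
  proof -
    obtain T where "n * (n - 1) div 2 = T" "2 * T = n * n - n"
      by (rule triangle_obtain)
    then show ?thesis
      by (simp add: right_diff_distrib)
  qed
  ultimately have "0 \<le> ?e"
    by simp
  have "12 * (3 * t\<^sup>2 - t * y + 3 * y\<^sup>2 - 27) = ((6 * t - y)\<^sup>2 - 289) + 35 * (y\<^sup>2 - 1)"
    by (simp add: power2_eq_square algebra_simps)
  also have "\<dots> = 840 * m + 420 * (n * (3 * n - 1))"
    unfolding m assms(2) by (simp add: power2_eq_square algebra_simps)
  also have "\<dots> = 12 * ((m + ?e) * 70)"
    unfolding e[symmetric] by (simp add: algebra_simps)
  finally have "3 * t\<^sup>2 - t * y + 3 * y\<^sup>2 - 27 = (m + ?e) * 70"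
    by simp
  then have "(3 * t\<^sup>2 - t * y + 3 * y\<^sup>2 - 27) div 70 = m + ?e"
    by (simp only: nonzero_mult_div_cancel_right)
  then show ?thesis
    unfolding lattice_term_def prod.case m
    using \<open>0 \<le> m\<close> \<open>0 \<le> ?e\<close> by (simp add: nat_add_distrib power_add)
qed

text \<open>The factor (q;q)_inf is expanded by Euler's pentagonal number theorem, the triple
  product with m = 3 and a = 1. A pair (x, n) goes to y = 6 n - 1 or 1 - 6 n, the sign being chosen
  so that 6 divides x + y.\<close>

lemma has_sum_odd_lattice:
  assumes q: "norm q < 1" "q \<noteq> 0"
    and F: "((\<lambda>x. root_sign x * q ^ nat ((x\<^sup>2 - 289) div 840)) has_sum F) root_set"
  shows "((\<lambda>p. odd_sign p * lattice_term q p) has_sum (F * qpoch_inf q q))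
    {p \<in> odd_lattice. \<not> 3 dvd snd p}"
proof -
  have "qpoch_inf q q = qpoch_infs [q, q ^ 2, q ^ 3] (q ^ 3)"
    using qpoch_inf_eq_prod_power[of q 3 q] q
    by (simp add: qpoch_infs_def eval_nat_numeral mult_ac)
  then have "((\<lambda>n. (-1) powi n * q ^ nat (3 * (n * (n - 1) div 2) + n)) has_sum qpoch_inf q q) UNIV"
    using has_sum_theta_power[OF q, of 1 3] by simp
  with F have "((\<lambda>(x, n). (root_sign x * q ^ nat ((x\<^sup>2 - 289) div 840)) *
      ((-1) powi n * q ^ nat (3 * (n * (n - 1) div 2) + n))) has_sum (F * qpoch_inf q q))
      (root_set \<times> UNIV)"
    by (rule has_sum_Times)
  also have "?this \<longleftrightarrow> ?thesis"
  proof -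
    define i :: "int \<times> int \<Rightarrow> int \<times> int" where
      "i = (\<lambda>(t, y). (6 * t - y, if y mod 3 = 2 then (y + 1) div 6 else (1 - y) div 6))"
    define j :: "int \<times> int \<Rightarrow> int \<times> int" where
      "j = (\<lambda>(x, n). if x mod 3 = 1 then ((x - 1) div 6 + n, 6 * n - 1)
        else ((x + 1) div 6 - n, 1 - 6 * n))"
    have "(6 * n - 1) mod 3 = 2" "(1 - 6 * n) mod 3 = 1" for n :: int
      by presburger+
    then have i: "i (t, 6 * n - 1) = (6 * (t - n) + 1, n)" "i (t, 1 - 6 * n) = (6 * (t + n) - 1, n)"
      for t n
      by (simp_all add: i_def)
    have "(6 * u + 1) mod 3 = 1" "(6 * u - 1) mod 3 = 2" for u :: int
      by presburger+
    then have j: "j (6 * u + 1, n) = (u + n, 6 * n - 1)" "j (6 * u - 1, n) = (u - n, 1 - 6 * n)"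
      for u n
      by (simp_all add: j_def)
    have cases6: "\<exists>u. z = 6 * u + 1 \<or> z = 6 * u - 1" if "odd z" "\<not> 3 dvd z" for z :: int
      using that by presburger
    have S: "\<exists>u n. p = (6 * u + 1, n) \<or> p = (6 * u - 1, n)" if "p \<in> root_set \<times> UNIV" for p
      using that cases6 unfolding root_set_def by blast
    have T: "\<exists>t n. p = (t, 6 * n - 1) \<or> p = (t, 1 - 6 * n)"
      if mem: "p \<in> {p \<in> odd_lattice. \<not> 3 dvd snd p}" for p
    proof -
      obtain t y where p: "p = (t, y)"
        by fastforce
      obtain n where "- y = 6 * n + 1 \<or> - y = 6 * n - 1"
        using mem cases6[of "- y"] unfolding p odd_lattice_def by auto
      then have "y = 6 * (- n) - 1 \<or> y = 1 - 6 * n"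
        by auto
      then show ?thesis
        unfolding p by blast
    qed
    show ?thesis
    proof (rule has_sum_reindex_bij_witness[of _ i j])
      fix p assume p: "p \<in> root_set \<times> (UNIV :: int set)"
      then show "i (j p) = p"
        using S by (fastforce simp: i j)
      obtain x n where xn: "p = (x, n)" "x \<in> root_set"
        using p by auto
      obtain t y where ty: "j p = (t, y)"
        by fastforce
      \<comment> \<open>Writing x = 6 u + 1 or 6 u - 1, the class modulo 12 is decided by the parity
        of u, and t is u + n or u - n.\<close>
      have "6 * t - y = x \<and> y\<^sup>2 = (6 * n - 1)\<^sup>2 \<and>
          (x mod 12 \<in> {1, 11} \<longleftrightarrow> even (t + n))"
      proof -
        have mod_12: "(6 * u + 1) mod 12 \<in> {1, 11} \<longleftrightarrow> even u"
          "(6 * u - 1) mod 12 \<in> {1, 11} \<longleftrightarrow> even u" for u :: int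
          unfolding insert_iff empty_iff by presburger+
        consider u where "x = 6 * u + 1" | u where "x = 6 * u - 1"
          using S[OF p] xn(1) by auto
        then show ?thesis
        proof cases
          case (1 u)
          have "t = u + n" "y = 6 * n - 1"
            using ty unfolding xn(1) 1 j by auto
          then show ?thesis
            unfolding 1 mod_12 by simp
        next
          case (2 u)
          have "t = u - n" "y = 1 - 6 * n"
            using ty unfolding xn(1) 2 j by auto
          then show ?thesis
            unfolding 2 mod_12 by (simp add: power2_commute[of "6 * n" 1])
        qed
      qed
      then have x: "6 * t - y = x" and y: "y\<^sup>2 = (6 * n - 1)\<^sup>2"
        and parity: "x mod 12 \<in> {1, 11} \<longleftrightarrow> even (t + n)"
        by auto
      have mem: "(t, y) \<in> odd_lattice \<and> \<not> 3 dvd y"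
        using xn(2) unfolding x[symmetric] root_set_iff_odd_lattice .
      then show "j p \<in> {p \<in> odd_lattice. \<not> 3 dvd snd p}"
        by (simp add: ty)
      have "(6 * t - y) mod 7 = (- y - t) mod 7"
        unfolding mod_eq_dvd_iff by simp
      then have "x mod 7 = 4 \<longleftrightarrow> (t + y) mod 7 = 3"
        unfolding x neg_mod_7[symmetric] by simp
      then have "odd_sign (t, y) = root_sign x * (-1) powi n"
        unfolding odd_sign_def root_sign_def parity prod.case minus_one_powi_int by auto
      moreover have "lattice_term q (t, y) = q ^ nat ((x\<^sup>2 - 289) div 840) *
          q ^ nat (3 * (n * (n - 1) div 2) + n)"
        using lattice_term_eq_mult[of t y n q] y xn(2) unfolding x by blast
      ultimately show "odd_sign (j p) * lattice_term q (j p) =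
          (case p of (x, n) \<Rightarrow> (root_sign x * q ^ nat ((x\<^sup>2 - 289) div 840)) *
          ((-1) powi n * q ^ nat (3 * (n * (n - 1) div 2) + n)))"
        unfolding ty unfolding xn(1) prod.case by (simp only: mult_ac)
    next
      fix p assume p: "p \<in> {p \<in> odd_lattice. \<not> 3 dvd snd p}"
      show "j (i p) = p"
        using T[OF p] by (elim exE disjE) (simp_all only: i j diff_add_cancel add_diff_cancel_right')
      obtain t y where ty: "p = (t, y)"
        by fastforce
      have "6 * t - y \<in> root_set"
        using p unfolding ty root_set_iff_odd_lattice by simp
      then show "i p \<in> root_set \<times> UNIV"
        by (simp add: i_def ty)
    qed simp
  qed
  finally show ?thesis .
qed

subsection \<open>The square roots of 289 modulo 840\<close>

text \<open>The positive solutions of x^2 = 289 modulo 840 in increasing order. They have period 420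
  because (x + 420)^2 - x^2 = 840 (x + 210); the table lists those below 420.\<close>

definition root_nth :: "nat \<Rightarrow> nat" where
  "root_nth n = 420 * (n div 16) +
    [17, 53, 67, 73, 137, 143, 157, 193, 227, 263, 277, 283, 347, 353, 367, 403] ! (n mod 16)"

lemma all_less_16_iff:
  "(\<forall>r<16. P r) \<longleftrightarrow> list_all P [0, 1, 2, 3, 4, 5, 6, 7, 8, 9, 10, 11, 12, 13, 14, 15 :: nat]"
proof -
  have "[0, 1, 2, 3, 4, 5, 6, 7, 8, 9, 10, 11, 12, 13, 14, 15] = [0..<16]"
    by (simp add: upt_rec)
  then show ?thesis
    by (simp only: list_all_iff set_upt atLeastLessThan_iff) auto
qed

lemma root_nth_shift: "root_nth (16 * k + r) = 420 * k + root_nth r"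
  by (simp add: root_nth_def)

lemma strict_mono_root_nth: "strict_mono root_nth"
proof (rule strict_mono_Suc_iff[THEN iffD2], rule allI)
  fix n
  \<comment> \<open>The case r = 15 compares 403 with 437, the first entry of the next
    period.\<close>
  have "\<forall>r<16. root_nth r < root_nth (r + 1)"
    unfolding all_less_16_iff by (simp add: root_nth_def)
  then have "root_nth (n mod 16) < root_nth (n mod 16 + 1)"
    by simp
  then show "root_nth n < root_nth (Suc n)"
    using root_nth_shift[of "n div 16" "n mod 16"] root_nth_shift[of "n div 16" "Suc (n mod 16)"]
    by simp
qed

lemma root_nth_square: "(root_nth n)\<^sup>2 mod 840 = 289"
proof -
  define k c where "k = n div 16" and "c = root_nth (n mod 16)"
  have n: "root_nth n = 420 * k + c"
    using root_nth_shift[of k "n mod 16"] by (simp add: k_def c_def)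
  have "\<forall>r<16. (root_nth r)\<^sup>2 mod 840 = 289"
    unfolding all_less_16_iff by (simp add: root_nth_def)
  then have "c\<^sup>2 mod 840 = 289"
    by (simp add: c_def)
  moreover have "(root_nth n)\<^sup>2 = c\<^sup>2 + 840 * (210 * k\<^sup>2 + k * c)"
    unfolding n by (simp add: power2_eq_square algebra_simps)
  ultimately show ?thesis
    by (simp only: mod_mult_self2)
qed

text \<open>Reduction modulo 420 suffices: the table exhausts the residues whose square is 289
  modulo 420.\<close>

lemma root_nth_surj:
  assumes "x\<^sup>2 mod 840 = 289"
  shows "\<exists>n. root_nth n = x"
proof -
  have all: "\<forall>c\<in>set [0..419::int]. c\<^sup>2 mod 420 = 289 \<longrightarrow>
      c \<in> set [17, 53, 67, 73, 137, 143, 157, 193, 227, 263, 277, 283, 347, 353, 367, 403]"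
    by code_simp
  have "(x mod 420)\<^sup>2 mod 420 = (x\<^sup>2 mod 840) mod 420"
    by (simp add: power_mod mod_mod_cancel)
  then have "(x mod 420)\<^sup>2 mod 420 = 289"
    using assms by simp
  then have "int ((x mod 420)\<^sup>2 mod 420) = int 289"
    by (rule arg_cong)
  then have "(int (x mod 420))\<^sup>2 mod 420 = 289"
    by (simp only: of_nat_power of_nat_mod of_nat_numeral)
  moreover have "int (x mod 420) \<in> set [0..419]"
    by simp
  ultimately have "int (x mod 420) \<in> set
      [17, 53, 67, 73, 137, 143, 157, 193, 227, 263, 277, 283, 347, 353, 367, 403]"
    using all by blast
  also have "[17, 53, 67, 73, 137, 143, 157, 193, 227, 263, 277, 283, 347, 353, 367, 403] =
      map (\<lambda>r. int (root_nth r)) [0, 1, 2, 3, 4, 5, 6, 7, 8, 9, 10, 11, 12, 13, 14, 15]"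
    by (simp add: root_nth_def)
  finally obtain r where "int (x mod 420) = int (root_nth r)"
    unfolding set_map by (rule imageE)
  then have "root_nth (16 * (x div 420) + r) = x"
    unfolding root_nth_shift of_nat_eq_iff by (metis mult_div_mod_eq)
  then show ?thesis ..
qed

lemma enumerate_range_strict_mono:
  fixes f :: "nat \<Rightarrow> nat"
  assumes "strict_mono f"
  shows "enumerate (range f) n = f n"
proof (induction n)
  case 0
  show ?case
    unfolding enumerate_0
    using assms by (intro Least_equality) (auto simp: strict_mono_less_eq)
next
  case (Suc n)
  have "infinite (range f)"
    using assms by (simp add: range_inj_infinite strict_mono_imp_inj_on)
  then show ?case
    unfolding enumerate_Suc''[OF \<open>infinite (range f)\<close>] Suc
    using assms by (intro Least_equality) (auto simp: strict_mono_less_eq strict_mono_less)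
qed

text \<open>The quotients (x^2 - 289) / 840 along the increasing list of roots increase strictly and
  run through \<open>sq_indices\<close>, so they are its enumeration.\<close>

lemma root_nth_square_eq: "840 * a_seq n + 289 = (root_nth n)\<^sup>2"
proof -
  define b where "b n = (root_nth n)\<^sup>2 div 840" for n
  have b: "840 * b n + 289 = (root_nth n)\<^sup>2" for n
    using mult_div_mod_eq[of 840 "(root_nth n)\<^sup>2"] unfolding b_def root_nth_square .
  have "strict_mono b"
  proof (rule strict_monoI)
    fix m n :: nat assume "m < n"
    then have "(root_nth m)\<^sup>2 < (root_nth n)\<^sup>2"
      using strict_mono_root_nth by (simp add: strict_mono_less power_strict_mono)
    then show "b m < b n"
      using b[of m] b[of n] by linarith
  qed
  have "range b = sq_indices"
  proof (intro equalityI subsetI)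
    fix m assume "m \<in> range b"
    then show "m \<in> sq_indices"
      using b unfolding sq_indices_def is_nth_power_def by blast
  next
    fix m assume "m \<in> sq_indices"
    then obtain x where x: "840 * m + 289 = x\<^sup>2"
      unfolding sq_indices_def is_nth_power_def by blast
    then have "x\<^sup>2 mod 840 = 289"
      by (simp flip: x)
    then obtain n where "root_nth n = x"
      using root_nth_surj by blast
    then have "m = b n"
      using x b[of n] by simp
    then show "m \<in> range b"
      by blast
  qed
  then show ?thesis
    using enumerate_range_strict_mono[OF \<open>strict_mono b\<close>, of n] b[of n] by (simp add: a_seq_def)
qed

section \<open>Signed roots and the sign pattern\<close>

text \<open>Every root is 2 or 3 modulo 5, so this sign makes the residue 2, as
  \<open>root_set\<close> demands.\<close>

definition signed_root :: "nat \<Rightarrow> int" where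
  "signed_root n = (if root_nth n mod 5 = 2 then int (root_nth n) else - int (root_nth n))"

text \<open>Reduces congruence statements to the sixteen table entries. The choice of sign depends
  only on the root modulo 5, hence only on \<open>n mod 16\<close>.\<close>

lemma signed_root_mod_16:
  assumes "m dvd 420"
  shows "signed_root n mod m = signed_root (n mod 16) mod m"
proof -
  have n: "root_nth n = 420 * (n div 16) + root_nth (n mod 16)"
    using root_nth_shift[of "n div 16" "n mod 16"] by simp
  have "(420 * k + c) mod 5 = c mod 5" for k c :: nat
    using mod_mult_self4[of 5 "84 * k" c] by simp
  then have "root_nth n mod 5 = root_nth (n mod 16) mod 5"
    unfolding n .
  then have "signed_root n - signed_root (n mod 16)
      = 420 * (if root_nth n mod 5 = 2 then int (n div 16) else - int (n div 16))"
    unfolding signed_root_def using n by simp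
  then show ?thesis
    unfolding mod_eq_dvd_iff using assms by (simp only: dvd_mult2)
qed

lemma signed_root_in_root_set: "signed_root n \<in> root_set"
proof -
  have "\<forall>r<16. signed_root r mod 2 = 1 \<and> signed_root r mod 3 \<noteq> 0 \<and>
      signed_root r mod 5 = 2 \<and> signed_root r mod 7 \<in> {3, 4}"
    unfolding all_less_16_iff by (simp add: signed_root_def root_nth_def)
  then have "signed_root (n mod 16) mod 2 = 1 \<and> signed_root (n mod 16) mod 3 \<noteq> 0 \<and>
      signed_root (n mod 16) mod 5 = 2 \<and> signed_root (n mod 16) mod 7 \<in> {3, 4}"
    by simp
  then show ?thesis
    unfolding root_set_def odd_iff_mod_2_eq_one dvd_eq_mod_eq_0 mem_Collect_eq
    by (simp add: signed_root_mod_16[of _ n])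
qed

text \<open>The sign is 1 exactly when the conditions modulo 12 and 7 agree; over one period this
  reproduces the table in \<open>t_seq\<close>.\<close>

lemma root_sign_signed_root: "root_sign (signed_root n) = (-1) ^ t_seq n"
proof -
  have "\<forall>r<16. (signed_root r mod 12 \<in> {1, 11} \<longleftrightarrow> signed_root r mod 7 = 4)
      \<longleftrightarrow> t_seq r = 0"
    unfolding all_less_16_iff by (simp add: signed_root_def root_nth_def t_seq_def)
  then have "(signed_root (n mod 16) mod 12 \<in> {1, 11} \<longleftrightarrow> signed_root (n mod 16) mod 7 = 4)
      \<longleftrightarrow> t_seq (n mod 16) = 0"
    by simp
  moreover have "t_seq (n mod 16) = t_seq n" "t_seq n \<in> {0, 1}"
    by (simp_all add: t_seq_def)
  ultimately show ?thesis
    unfolding root_sign_def signed_root_mod_16[of 12 n, simplified] signed_root_mod_16[of 7 n, simplified]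
    by auto
qed

lemma signed_root_square: "(signed_root n)\<^sup>2 = int ((root_nth n)\<^sup>2)"
  by (simp add: signed_root_def)

text \<open>Squares determine the index. Conversely |x| is some \<open>root_nth n\<close>, and the
  residue modulo 5 decides between x and -x.\<close>

lemma bij_betw_signed_root: "bij_betw signed_root UNIV root_set"
proof (rule bij_betw_imageI)
  show "inj signed_root"
  proof (rule injI)
    fix m n assume "signed_root m = signed_root n"
    then have "(root_nth m)\<^sup>2 = (root_nth n)\<^sup>2"
      using signed_root_square by (metis of_nat_eq_iff)
    then show "m = n"
      using strict_mono_root_nth by (simp add: strict_mono_eq)
  qed
  show "range signed_root = root_set"
  proof (intro equalityI subsetI)
    fix x assume x: "x \<in> root_set"
    have "x\<^sup>2 mod 840 = 289 mod 840"
      using root_set_square(1)[OF x] by (simp only: mod_eq_dvd_iff)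
    then have "int ((nat \<bar>x\<bar>)\<^sup>2 mod 840) = int 289"
      by (simp add: zmod_int)
    then obtain n where "root_nth n = nat \<bar>x\<bar>"
      using root_nth_surj of_nat_eq_iff by blast
    then have "signed_root n = x \<or> signed_root n = - x"
      by (auto simp: signed_root_def)
    moreover have "signed_root n mod 5 = 2" "x mod 5 = 2"
      using signed_root_in_root_set[of n] x by (auto simp: root_set_def)
    ultimately have "signed_root n = x"
      by presburger
    then show "x \<in> range signed_root"
      by blast
  qed (use signed_root_in_root_set in blast)
qed

section \<open>Assembly of the identity\<close>

theorem theorem4:
  fixes q :: complex
  assumes "norm q < 1"
  shows "(\<lambda>n. (-1) ^ t_seq n * q ^ a_seq n) sums
           (qpoch_infs [q ^ 2, q ^ 5, q ^ 7] (q ^ 7) / qpoch_infs [q ^ 2, q ^ 3] (q ^ 5))"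
proof (cases "q = 0")
  case True
  \<comment> \<open>At \<open>q = 0\<close> only the term n = 0 survives, and both sides are
    1.\<close>
  have "a_seq n = 0 \<longleftrightarrow> n = 0" for n
  proof -
    have "a_seq 0 = 0"
      using root_nth_square_eq[of 0] by (simp add: root_nth_def)
    then show ?thesis
      using strict_mono_eq[OF strict_mono_a_seq, of n 0] by simp
  qed
  then have "(\<lambda>n. (-1) ^ t_seq n * q ^ a_seq n) = (\<lambda>n. if n = 0 then 1 else 0)"
    using True by (auto simp: fun_eq_iff t_seq_def power_0_left)
  then show ?thesis
    using sums_single[of 0 "\<lambda>_. 1 :: complex"] True
    by (simp add: qpoch_infs_def qpoch_inf_def power_0_left)
next
  case False
  note q = assms False
  let ?f = "\<lambda>n. (-1) ^ t_seq n * q ^ a_seq n"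
  let ?P7 = "qpoch_infs [q ^ 2, q ^ 5, q ^ 7] (q ^ 7)"
  let ?P5 = "qpoch_infs [q, q ^ 4, q ^ 5] (q ^ 5)"
  let ?D = "qpoch_infs [q ^ 2, q ^ 3] (q ^ 5)"
  have norm_summable: "summable (\<lambda>n. norm (?f n))"
  proof (rule summable_comparison_test'[of "\<lambda>n. norm q ^ n" 0])
    fix n
    show "norm (norm (?f n)) \<le> norm q ^ n"
      using assms strict_mono_imp_increasing[OF strict_mono_a_seq, of n]
      by (simp add: norm_mult norm_power power_decreasing)
  qed (use assms in \<open>simp add: summable_geometric\<close>)
  define F where "F = suminf ?f"
  have sums: "?f sums F"
    unfolding F_def using summable_norm_cancel[OF norm_summable] by (rule summable_sums)
  have "(?f has_sum F) UNIV"
    using norm_summable sums by (rule norm_summable_imp_has_sum)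
  moreover have "?f n = root_sign (signed_root n) * q ^ nat (((signed_root n)\<^sup>2 - 289) div 840)" for n
    unfolding signed_root_square root_nth_square_eq[symmetric] root_sign_signed_root by simp
  ultimately have "((\<lambda>x. root_sign x * q ^ nat ((x\<^sup>2 - 289) div 840)) has_sum F) root_set"
    using has_sum_reindex_bij_betw[OF bij_betw_signed_root,
      of "\<lambda>x. root_sign x * q ^ nat ((x\<^sup>2 - 289) div 840)" F] by simp
  \<comment> \<open>The two lattice sums give the product of \<open>F\<close> and (q;q)_inf in
    closed form.\<close>
  from infsumI[OF has_sum_odd_lattice[OF q this]]
  have "F * qpoch_inf q q = ?P7 * ?P5"
    unfolding lattice_sums_eq[OF q] infsumI[OF has_sum_theta_lattice[OF q]] by (rule sym)
  moreover have "qpoch_inf q q = ?P5 * ?D"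
  proof -
    have "{..<5} = {0, 1, 2, 3, 4 :: nat}"
      by auto
    then show ?thesis
      using qpoch_inf_eq_prod_power[of q 5 q] assms
      by (simp add: qpoch_infs_def mult_ac flip: power_Suc numeral_2_eq_2)
  qed
  moreover have "qpoch_inf q q \<noteq> 0"
    using assms by (rule qpoch_inf_self_nonzero)
  \<comment> \<open>As (q;q)_inf is the product of \<open>?P5\<close> and \<open>?D\<close> and does
    not vanish, both factors can be cancelled.\<close>
  ultimately have "?P5 * (F * ?D) = ?P5 * ?P7" "?P5 \<noteq> 0" "?D \<noteq> 0"
    by (simp_all only: mult_ac) auto
  then have "F = ?P7 / ?D"
    by (simp only: mult_left_cancel eq_divide_eq) simp
  then show ?thesis
    using sums by simp
qed

end
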